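(* Let $n\ge5$ be an integer, write $z=re^{i\theta}$ with $0<r<\infty$ and $\theta\in\mathbb{R}$, and let $$f_n(r,\theta)=r^{2n-4}+2(n-1)\left|\cos\frac{n\theta}{2}\right|r^{n/2}(r^{n-4}-1)-(n-1)^2r^n+(n-1)^2r^{n-4}-1.$$ Then the following hold. (1) For every $\theta\in\mathbb{R}$, the equation $f_n(r,\theta)=0$ has exactly three positive zeroes $r=r_D$, $r=1$, $r=r_E$ (where $r_D=r_D(\theta)$, $r_E=r_E(\theta)$), and $r_D<1<r_E=1/r_D$. In addition, $r_E<(n-1)^{2/(n-4)}$, so the zeroes converge to $1$ as $n\to\infty$. (2) With the sets $D,\partial D,K_0,S^1,K_1,\partial E,E$ defined in the context, - $f_n(r,\theta)=0\iff|L_p(z)|=1/|z|\iff z\in\partial D\cup S^1\cup\partial E$; - $f_n(r,\theta)<0\iff|L_p(z)|>1/|z|\iff z\in D\cup K_1$; - $f_n(r,\theta)>0\iff|L_p(z)|<1/|z|\iff z\in K_0\cup E$. (3) The sets $\partial D$ and $\partial E$ are the polar curves $r=r_D(\theta)$ and $r=r_E(\theta)$, respectively. The function $r_D(\theta)$ is maximized at every angle $\theta=\theta_0$ and minimized at every angle $\theta=\theta_1$, while the function $r_E(\theta)$ is minimized at every $\theta=\theta_0$ and maximized at every $\theta=\theta_1$, where $\theta_0$ stands for any of the angles $\frac{2k\pi}{n}$ and $\theta_1$ for any of the angles $\frac{(2k+1)\pi}{n}$, $k=0,\dots,n-1$ (modulo $2\pi$). In addition, both $r_D(\theta)$ and $r_E(\theta)$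 are monotonic between any two consecutive angles $\theta_0$ and $\theta_1$.
   Context: $\sqrt{w}$ denotes the principal square root: if $w=\rho e^{i\phi}$ with $\rho>0$ and $-\pi<\phi\le\pi$, then $\sqrt{w}=\sqrt{\rho}\,e^{i\phi/2}$. The Laguerre iteration function of $p_n(z)=z^n-1$ is $$L_p(z)=z\,\frac{\frac{1}{\sqrt{z^n}}+(n-1)}{\sqrt{z^n}+(n-1)},\qquad z\in\mathbb{C}\setminus\{0\}.$$ The following subsets of $\mathbb{C}\setminus\{0\}$ are defined: $D=\{0<|z|<1,\ |L_p(z)|>1/|z|\}$, $\partial D=\{0<|z|<1,\ |L_p(z)|=1/|z|\}$, $K_0=\{0<|z|<1,\ |L_p(z)|<1/|z|\}$, $S^1=\{|z|=1\}$, $K_1=\{|z|>1,\ |L_p(z)|>1/|z|\}$, $\partial E=\{|z|>1,\ |L_p(z)|=1/|z|\}$, $E=\{|z|>1,\ |L_p(z)|<1/|z|\}$. (Here $\partial D$ and $\partial E$ are names for the sets so defined.) *)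

theory Defs
  imports "HOL-Analysis.Analysis"
begin

text \<open>\<^const>\<open>csqrt\<close> is the principal square root: its argument lies in the half-open
  interval from \<open>-pi/2\<close> (excluded) to \<open>pi/2\<close> (included), and negative reals are sent to
  the positive imaginary axis.\<close>

definition laguerre :: "nat \<Rightarrow> complex \<Rightarrow> complex" where
  "laguerre n z =
     z * ((1 / csqrt (z ^ n) + (of_nat n - 1)) / (csqrt (z ^ n) + (of_nat n - 1)))"

text \<open>The exponents \<open>2 * n - 4\<close> and \<open>n - 4\<close> are natural numbers; the subtraction is
  not truncated for \<open>n \<ge> 4\<close>. The exponent \<open>n / 2\<close> may be a half-integer.\<close>

definition lag_f :: "nat \<Rightarrow> real \<Rightarrow> real \<Rightarrow> real" where
  "lag_f n r \<theta> =
     r ^ (2 * n - 4)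
     + 2 * (real n - 1) * \<bar>cos (real n * \<theta> / 2)\<bar> * (r powr (real n / 2)) * (r ^ (n - 4) - 1)
     - (real n - 1)\<^sup>2 * r ^ n + (real n - 1)\<^sup>2 * r ^ (n - 4) - 1"

definition set_D :: "nat \<Rightarrow> complex set" where
  "set_D n = {z. 0 < cmod z \<and> cmod z < 1 \<and> cmod (laguerre n z) > 1 / cmod z}"

text \<open>The names \<open>bd_D\<close> and \<open>bd_E\<close> denote the sets below, not topological frontiers.\<close>

definition bd_D :: "nat \<Rightarrow> complex set" where
  "bd_D n = {z. 0 < cmod z \<and> cmod z < 1 \<and> cmod (laguerre n z) = 1 / cmod z}"

definition set_K0 :: "nat \<Rightarrow> complex set" where
  "set_K0 n = {z. 0 < cmod z \<and> cmod z < 1 \<and> cmod (laguerre n z) < 1 / cmod z}"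

definition unit_circle :: "complex set" where
  "unit_circle = {z. cmod z = 1}"

definition set_K1 :: "nat \<Rightarrow> complex set" where
  "set_K1 n = {z. cmod z > 1 \<and> cmod (laguerre n z) > 1 / cmod z}"

definition bd_E :: "nat \<Rightarrow> complex set" where
  "bd_E n = {z. cmod z > 1 \<and> cmod (laguerre n z) = 1 / cmod z}"

definition set_E :: "nat \<Rightarrow> complex set" where
  "set_E n = {z. cmod z > 1 \<and> cmod (laguerre n z) < 1 / cmod z}"

definition polar_curve :: "(real \<Rightarrow> real) \<Rightarrow> complex set" where
  "polar_curve \<rho> = {rcis (\<rho> \<theta>) \<theta> | \<theta>. True}"

definition angles0 :: "nat \<Rightarrow> real set" where
  "angles0 n = {2 * real k * pi / real n + 2 * pi * real_of_int m | k m. k < n}"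

definition angles1 :: "nat \<Rightarrow> real set" where
  "angles1 n = {(2 * real k + 1) * pi / real n + 2 * pi * real_of_int m | k m. k < n}"

definition consecutive_in :: "real set \<Rightarrow> real \<Rightarrow> real \<Rightarrow> bool" where
  "consecutive_in A a b \<longleftrightarrow> a \<in> A \<and> b \<in> A \<and> a < b \<and> A \<inter> {a<..<b} = {}"

definition monotonic_on :: "real set \<Rightarrow> (real \<Rightarrow> real) \<Rightarrow> bool" where
  "monotonic_on I g \<longleftrightarrow> mono_on I g \<or> antimono_on I g"

definition maximized_at :: "(real \<Rightarrow> real) \<Rightarrow> real \<Rightarrow> bool" where
  "maximized_at g a \<longleftrightarrow> (\<forall>\<theta>. g \<theta> \<le> g a)"

definition minimized_at :: "(real \<Rightarrow> real) \<Rightarrow> real \<Rightarrow> bool" where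
  "minimized_at g a \<longleftrightarrow> (\<forall>\<theta>. g a \<le> g \<theta>)"

end

theory Submission
  imports Defs "HOL-Real_Asymp.Real_Asymp"
begin

text \<open>
  The problem becomes one-dimensional in logarithmic polar coordinates. With \<open>r = exp t\<close> and
  \<open>c = \<bar>cos (n * \<theta> / 2)\<bar>\<close>, the function \<open>lag_f\<close> is \<open>2 * exp ((n - 2) * t)\<close> times
  \<open>g t = sinh ((n - 2) * t) + 2 * (n - 1) * c * sinh ((n - 4) / 2 * t) - (n - 1)\<^sup>2 * sinh (2 * t)\<close>
  (lemma \<open>lag_f_exp\<close>, where \<open>g\<close> is called \<open>hyp_f\<close>). This form shows the symmetry of the problem:
  \<open>g\<close> is odd, so the zeros other than \<open>r = 1\<close> come in pairs \<open>r\<close>, \<open>1 / r\<close>, and it remains to show that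
  \<open>g\<close> has a unique zero on \<open>t > 0\<close>.

  For \<open>n < 8\<close> the frequency \<open>(n - 4) / 2\<close> is less than \<open>2\<close>, and the sign pattern \<open>+ - +\<close> of the
  coefficients alone would allow two zeros. Uniqueness comes from the inequality \<open>g'' > 4 * g\<close> on \<open>t > 0\<close> for all \<open>n \<ge> 5\<close>
  (lemma \<open>hyp_f_convexity\<close>). As \<open>sinh (2 * t)\<close> solves \<open>u'' = 4 * u\<close>, a Sturm-type
  comparison of \<open>g\<close> with it shows that \<open>g t / sinh (2 * t)\<close> is strictly increasing. So \<open>g\<close> has at
  most one positive zero and passes from negative to positive there. It has one because
  \<open>g' 0 < 0\<close> and \<open>g t > 0\<close> at \<open>exp t = (n - 1) powr (2 / (n - 4))\<close>, which also gives the upper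
  bound for \<open>r_E\<close> and hence the limits. Since \<open>g\<close> increases with \<open>c\<close> on \<open>t > 0\<close>, its positive zero
  decreases with \<open>c\<close>.

  Everything about the shape of the curves now comes from
  \<open>\<bar>cos (n * \<theta> / 2)\<bar> = sqrt ((1 + cos (n * \<theta>)) / 2)\<close>: the radius \<open>r_E\<close> is a decreasing and \<open>r_D\<close> an
  increasing function of \<open>cos (n * \<theta>)\<close>, whose maxima, minima and intervals of monotonicity are
  those of the statement.

  Finally, for \<open>w = csqrt (z ^ n)\<close> and \<open>m = n - 1\<close>, one has \<open>L_p z = z * (1 + m * w) / (w * (w + m))\<close>,
  and comparing \<open>\<bar>L_p z\<bar>\<close> with \<open>1 / \<bar>z\<bar>\<close> amounts to comparing \<open>\<bar>w * (w + m)\<bar>\<close> with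
  \<open>r\<^sup>2 * \<bar>1 + m * w\<bar>\<close>. The difference of the squares of the last two expressions is
  \<open>r ^ 4 * lag_f n r \<theta>\<close> (lemma \<open>sgn_lag_f\<close>), because the principal square root satisfies
  \<open>Re w = \<bar>w\<bar> * \<bar>cos (n * \<theta> / 2)\<bar>\<close>.
\<close>

section \<open>The function in logarithmic polar coordinates\<close>

text \<open>The degree enters as a real number \<open>\<nu>\<close>, so that its inequalities are stated without coercions and
  truncated subtractions.\<close>

definition hyp_f :: "real \<Rightarrow> real \<Rightarrow> real \<Rightarrow> real" where
  "hyp_f \<nu> c t = sinh ((\<nu> - 2) * t) + 2 * (\<nu> - 1) * c * sinh ((\<nu> - 4) / 2 * t)
     - (\<nu> - 1)\<^sup>2 * sinh (2 * t)"

text \<open>The six exponents \<open>2 * n - 4\<close>, \<open>3 * n / 2 - 4\<close>, \<open>n\<close>, \<open>n / 2\<close>, \<open>n - 4\<close>, \<open>0\<close> are symmetric about \<open>n - 2\<close>, and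
  symmetric terms have opposite coefficients. Dividing by \<open>r ^ (n - 2)\<close> turns each pair into a hyperbolic
  sine.\<close>

lemma lag_f_exp:
  assumes "n \<ge> 4"
  shows "lag_f n (exp t) \<theta> =
    2 * exp ((real n - 2) * t) * hyp_f (real n) \<bar>cos (real n * \<theta> / 2)\<bar> t"
proof -
  define c where "c = \<bar>cos (real n * \<theta> / 2)\<bar>"
  have pow: "exp t ^ k = exp (real k * t)" for k
    by (rule exp_of_nat_mult[symmetric])
  have powr: "exp t powr (real n / 2) = exp (real n / 2 * t)"
    by (simp add: powr_def)
  have sinh: "2 * exp ((real n - 2) * t) * sinh y
      = exp ((real n - 2) * t + y) - exp ((real n - 2) * t - y)" for y
    by (simp add: sinh_def exp_add exp_diff exp_minus field_simps)
  have e1: "exp t ^ (2 * n - 4) - 1 = 2 * exp ((real n - 2) * t) * sinh ((real n - 2) * t)"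
    unfolding sinh pow using assms by (simp add: of_nat_diff algebra_simps)
  have e2: "exp t powr (real n / 2) * (exp t ^ (n - 4) - 1)
      = 2 * exp ((real n - 2) * t) * sinh ((real n - 4) / 2 * t)"
    unfolding sinh pow powr using assms
    by (simp add: of_nat_diff right_diff_distrib exp_add[symmetric])
       (simp add: field_simps)
  have e3: "exp t ^ n - exp t ^ (n - 4) = 2 * exp ((real n - 2) * t) * sinh (2 * t)"
    unfolding sinh pow using assms by (simp add: of_nat_diff algebra_simps)
  have "lag_f n (exp t) \<theta> = (exp t ^ (2 * n - 4) - 1)
      + 2 * (real n - 1) * c * (exp t powr (real n / 2) * (exp t ^ (n - 4) - 1))
      - (real n - 1)\<^sup>2 * (exp t ^ n - exp t ^ (n - 4))"
    unfolding lag_f_def c_def by (simp add: algebra_simps)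
  also have "\<dots> = 2 * exp ((real n - 2) * t) * hyp_f (real n) c t"
    unfolding e1 e2 e3 hyp_f_def by (simp add: algebra_simps)
  finally show ?thesis unfolding c_def .
qed

lemma hyp_f_odd: "hyp_f \<nu> c (- t) = - hyp_f \<nu> c t"
  by (simp add: hyp_f_def)

section \<open>The unique positive zero\<close>

text \<open>Both sides vanish at \<open>0\<close>, and their derivatives are \<open>a * b * cosh (b * t)\<close> and
  \<open>a * b * cosh (a * t)\<close>.\<close>

lemma sinh_ratio_less:
  fixes a b t :: real
  assumes "0 < b" "b < a" "0 < t"
  shows "a * sinh (b * t) < b * sinh (a * t)"
proof -
  let ?d = "\<lambda>t. b * sinh (a * t) - a * sinh (b * t)"
  have "?d 0 < ?d t"
  proof (rule DERIV_pos_imp_increasing_open[OF assms(3)])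
    fix x assume "0 < x" "x < t"
    hence "cosh (b * x) < cosh (a * x)"
      using assms by (intro cosh_real_strict_mono) auto
    moreover have "DERIV ?d x :> a * b * (cosh (a * x) - cosh (b * x))"
      by (auto intro!: derivative_eq_intros simp: algebra_simps)
    ultimately show "\<exists>y. DERIV ?d x :> y \<and> 0 < y" using assms by force
  qed (intro continuous_intros)
  thus ?thesis by simp
qed

definition hyp_f' :: "real \<Rightarrow> real \<Rightarrow> real \<Rightarrow> real" where
  "hyp_f' \<nu> c t = (\<nu> - 2) * cosh ((\<nu> - 2) * t) + (\<nu> - 1) * (\<nu> - 4) * c * cosh ((\<nu> - 4) / 2 * t)
     - 2 * (\<nu> - 1)\<^sup>2 * cosh (2 * t)"

definition hyp_f'' :: "real \<Rightarrow> real \<Rightarrow> real \<Rightarrow> real" where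
  "hyp_f'' \<nu> c t = (\<nu> - 2)\<^sup>2 * sinh ((\<nu> - 2) * t)
     + (\<nu> - 1) * (\<nu> - 4)\<^sup>2 / 2 * c * sinh ((\<nu> - 4) / 2 * t)
     - 4 * (\<nu> - 1)\<^sup>2 * sinh (2 * t)"

lemma hyp_f_deriv: "DERIV (hyp_f \<nu> c) t :> hyp_f' \<nu> c t"
  unfolding hyp_f_def hyp_f'_def
  by (auto intro!: derivative_eq_intros simp: field_simps)

lemma hyp_f'_deriv: "DERIV (hyp_f' \<nu> c) t :> hyp_f'' \<nu> c t"
  unfolding hyp_f'_def hyp_f''_def
  by (auto intro!: derivative_eq_intros simp: field_simps power2_eq_square)

text \<open>The \<open>sinh (2 * t)\<close> terms cancel in the difference. Of the other two, only the coefficient of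
  \<open>sinh ((\<nu> - 4) / 2 * t)\<close> can be negative, namely when \<open>\<nu> < 8\<close>. By \<open>sinh_ratio_less\<close> that term is
  dominated by the leading one if \<open>(\<nu> - 1) * (8 - \<nu>) \<le> 4 * (\<nu> - 2)\<close>. This is equivalent to
  \<open>\<nu> * (\<nu> - 5) \<ge> 0\<close>, which is where the bound \<open>5\<close> comes from.\<close>

lemma hyp_f_convexity:
  fixes \<nu> c t :: real
  assumes "\<nu> \<ge> 5" "0 \<le> c" "c \<le> 1" "0 < t"
  shows "4 * hyp_f \<nu> c t < hyp_f'' \<nu> c t"
proof -
  define A where "A = sinh ((\<nu> - 2) * t)"
  define B where "B = sinh ((\<nu> - 4) / 2 * t)"
  have B: "0 < B" unfolding B_def using assms by simp
  have "(\<nu> - 2) * B < (\<nu> - 4) / 2 * A"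
    unfolding A_def B_def by (rule sinh_ratio_less) (use assms in auto)
  hence AB: "2 * (\<nu> - 2) * B < (\<nu> - 4) * A" by (simp add: algebra_simps)
  have "c * ((\<nu> - 1) * (8 - \<nu>)) \<le> 4 * (\<nu> - 2)"
  proof -
    have "0 \<le> \<nu> * (\<nu> - 5)" using assms by simp
    hence "(\<nu> - 1) * (8 - \<nu>) \<le> 4 * (\<nu> - 2)" by (simp add: algebra_simps)
    hence "c * ((\<nu> - 1) * (8 - \<nu>)) \<le> c * (4 * (\<nu> - 2))"
      using assms by (intro mult_left_mono) auto
    also have "\<dots> \<le> 4 * (\<nu> - 2)" using assms by (simp add: mult_left_le_one_le)
    finally show ?thesis .
  qed
  hence "\<nu> / 2 * B * (c * ((\<nu> - 1) * (8 - \<nu>))) \<le> \<nu> / 2 * B * (4 * (\<nu> - 2))"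
    using assms B by (intro mult_left_mono) auto
  also have "\<dots> = \<nu> * (2 * (\<nu> - 2) * B)" by simp
  also have "\<dots> < \<nu> * ((\<nu> - 4) * A)"
    using AB assms by (intro mult_strict_left_mono) auto
  finally have "\<nu> / 2 * B * (c * ((\<nu> - 1) * (8 - \<nu>))) < \<nu> * ((\<nu> - 4) * A)" .
  moreover have "\<nu> * ((\<nu> - 4) * A) - \<nu> / 2 * B * (c * ((\<nu> - 1) * (8 - \<nu>)))
      = hyp_f'' \<nu> c t - 4 * hyp_f \<nu> c t"
    unfolding hyp_f''_def hyp_f_def A_def[symmetric] B_def[symmetric]
    by (simp add: field_simps power2_eq_square)
  ultimately show ?thesis by linarith
qed

text \<open>Sturm comparison with \<open>sinh (2 * t)\<close>: the numerator \<open>W\<close> of the derivative of the quotient is the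
  Wronskian of the two functions. It vanishes at \<open>0\<close> and has derivative
  \<open>(g'' - 4 * g) * sinh (2 * t) > 0\<close>.\<close>

lemma hyp_f_quotient_strict_mono:
  fixes \<nu> c s t :: real
  assumes "\<nu> \<ge> 5" "0 \<le> c" "c \<le> 1" "0 < s" "s < t"
  shows "hyp_f \<nu> c s / sinh (2 * s) < hyp_f \<nu> c t / sinh (2 * t)"
proof (rule DERIV_pos_imp_increasing[OF \<open>s < t\<close>])
  fix x assume "s \<le> x" "x \<le> t"
  hence x: "0 < x" using assms by simp
  let ?W = "\<lambda>x. hyp_f' \<nu> c x * sinh (2 * x) - 2 * hyp_f \<nu> c x * cosh (2 * x)"
  have dW: "DERIV ?W y :> (hyp_f'' \<nu> c y - 4 * hyp_f \<nu> c y) * sinh (2 * y)" for y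
    by (auto intro!: derivative_eq_intros hyp_f_deriv hyp_f'_deriv simp: algebra_simps)
  have "?W 0 < ?W x"
  proof (rule DERIV_pos_imp_increasing_open[OF x])
    fix y assume "0 < y" "y < x"
    hence "0 < (hyp_f'' \<nu> c y - 4 * hyp_f \<nu> c y) * sinh (2 * y)"
      using hyp_f_convexity[OF assms(1-3), of y] by simp
    with dW show "\<exists>z. DERIV ?W y :> z \<and> 0 < z" by blast
  next
    show "continuous_on {0..x} ?W"
      by (rule DERIV_continuous_on, rule has_field_derivative_at_within, rule dW)
  qed
  hence "0 < ?W x" by (simp add: hyp_f_def)
  moreover have "DERIV (\<lambda>x. hyp_f \<nu> c x / sinh (2 * x)) x :> ?W x / (sinh (2 * x))\<^sup>2"
    using x by (auto intro!: derivative_eq_intros hyp_f_deriv simp: field_simps power2_eq_square)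
  ultimately show "\<exists>y. DERIV (\<lambda>x. hyp_f \<nu> c x / sinh (2 * x)) x :> y \<and> 0 < y"
    using x by (auto intro!: exI)
qed

text \<open>The derivative at \<open>0\<close> increases with \<open>c\<close>, and at \<open>c = 1\<close> it equals \<open>- \<nu>\<^sup>2\<close>.\<close>

lemma hyp_f'_0_neg:
  fixes \<nu> c :: real
  assumes "\<nu> \<ge> 5" "0 \<le> c" "c \<le> 1"
  shows "hyp_f' \<nu> c 0 < 0"
proof -
  have "(\<nu> - 1) * (\<nu> - 4) * c \<le> (\<nu> - 1) * (\<nu> - 4)"
    using assms by (intro mult_left_le) auto
  moreover have "(\<nu> - 2) + (\<nu> - 1) * (\<nu> - 4) - 2 * (\<nu> - 1)\<^sup>2 = - \<nu>\<^sup>2"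
    by (simp add: algebra_simps power2_eq_square)
  moreover have "0 < \<nu>\<^sup>2" using assms by simp
  ultimately have "(\<nu> - 2) + (\<nu> - 1) * (\<nu> - 4) * c - 2 * (\<nu> - 1)\<^sup>2 < 0" by linarith
  thus ?thesis by (simp add: hyp_f'_def)
qed

text \<open>The point is chosen so that \<open>exp ((\<nu> - 2) * T) = m\<^sup>2 * exp (2 * T)\<close> with \<open>m = \<nu> - 1\<close>. The growing
  exponentials of the two terms without \<open>c\<close> then cancel, and the decaying ones leave a positive
  rest.\<close>

lemma hyp_f_pos_at_bound:
  fixes \<nu> c :: real
  assumes "\<nu> \<ge> 5" "0 \<le> c"
  shows "0 < hyp_f \<nu> c (2 * ln (\<nu> - 1) / (\<nu> - 4))"
proof -
  define m where "m = \<nu> - 1"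
  define T where "T = 2 * ln (\<nu> - 1) / (\<nu> - 4)"
  have T: "0 < T" unfolding T_def using assms by simp
  have m: "1 < m" using assms by (simp add: m_def)
  have "(\<nu> - 4) * T = 2 * ln m" unfolding T_def m_def using assms by simp
  hence "exp ((\<nu> - 4) * T) = m\<^sup>2" using m by (simp only: exp_double) simp
  hence "m\<^sup>2 * exp (2 * T) = exp ((\<nu> - 4) * T + 2 * T)" by (simp add: exp_add)
  also have "(\<nu> - 4) * T + 2 * T = (\<nu> - 2) * T" by (simp add: algebra_simps)
  finally have e: "m\<^sup>2 * exp (2 * T) = exp ((\<nu> - 2) * T)" .
  have "exp (- ((\<nu> - 2) * T)) < exp (- (2 * T))" using T assms by simp
  also have "\<dots> \<le> m\<^sup>2 * exp (- (2 * T))" using m by simp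
  finally have "m\<^sup>2 * sinh (2 * T) < sinh ((\<nu> - 2) * T)"
    using e by (simp add: sinh_def right_diff_distrib)
  moreover have "0 \<le> 2 * (\<nu> - 1) * c * sinh ((\<nu> - 4) / 2 * T)"
    using assms T by (intro mult_nonneg_nonneg) auto
  ultimately have "0 < hyp_f \<nu> c T" by (simp add: hyp_f_def m_def)
  thus ?thesis by (simp add: T_def)
qed

lemma hyp_f_unique_pos_root:
  fixes \<nu> c :: real
  assumes "\<nu> \<ge> 5" "0 \<le> c" "c \<le> 1"
  shows "\<exists>!t. 0 < t \<and> hyp_f \<nu> c t = 0"
proof (rule ex_ex1I)
  define T where "T = 2 * ln (\<nu> - 1) / (\<nu> - 4)"
  have T: "0 < T" unfolding T_def using assms by simp
  obtain d where d: "0 < d" "\<And>h. 0 < h \<Longrightarrow> h < d \<Longrightarrow> hyp_f \<nu> c (0 + h) < hyp_f \<nu> c 0"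
    using DERIV_neg_dec_right[OF hyp_f_deriv hyp_f'_0_neg[OF assms]] by blast
  \<comment> \<open>a point where the function is still negative, kept to the left of \<open>T\<close> for the intermediate
    value theorem\<close>
  define s where "s = min (d / 2) T"
  have s: "0 < s" "s \<le> T" "s < d" unfolding s_def using d T by auto
  have "hyp_f \<nu> c s < 0" using d(2)[of s] s by (simp add: hyp_f_def)
  moreover have "0 < hyp_f \<nu> c T"
    unfolding T_def using hyp_f_pos_at_bound assms by blast
  ultimately obtain t where "s \<le> t" "hyp_f \<nu> c t = 0"
    using IVT[of "hyp_f \<nu> c" s 0 T] s DERIV_isCont[OF hyp_f_deriv] by force
  with s show "\<exists>t. 0 < t \<and> hyp_f \<nu> c t = 0" by (intro exI[of _ t]) auto
next
  fix s t assume "0 < s \<and> hyp_f \<nu> c s = 0" "0 < t \<and> hyp_f \<nu> c t = 0"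
  thus "s = t"
    using hyp_f_quotient_strict_mono[OF assms, of s t]
      hyp_f_quotient_strict_mono[OF assms, of t s]
    by (cases s t rule: linorder_cases) auto
qed

text \<open>The logarithm of the radius of the outer curve in a direction \<open>\<theta>\<close> with
  \<open>\<bar>cos (\<nu> * \<theta> / 2)\<bar> = c\<close>.\<close>

definition log_radius :: "real \<Rightarrow> real \<Rightarrow> real" where
  "log_radius \<nu> c = (THE t. 0 < t \<and> hyp_f \<nu> c t = 0)"

context
  fixes \<nu> c :: real
  assumes \<nu>: "\<nu> \<ge> 5" and c: "0 \<le> c" "c \<le> 1"
begin

lemma log_radius_pos: "0 < log_radius \<nu> c"
  and hyp_f_log_radius: "hyp_f \<nu> c (log_radius \<nu> c) = 0"
  using theI'[OF hyp_f_unique_pos_root[OF \<nu> c]] by (auto simp: log_radius_def)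

lemma hyp_f_pos_iff:
  assumes "0 < t" shows "0 < hyp_f \<nu> c t \<longleftrightarrow> log_radius \<nu> c < t"
proof (cases t "log_radius \<nu> c" rule: linorder_cases)
  case less
  have "hyp_f \<nu> c t / sinh (2 * t) < 0"
    using hyp_f_quotient_strict_mono[OF \<nu> c assms less] by (simp add: hyp_f_log_radius)
  with less assms show ?thesis by (simp add: divide_less_0_iff)
next
  case greater
  have "0 < hyp_f \<nu> c t / sinh (2 * t)"
    using hyp_f_quotient_strict_mono[OF \<nu> c log_radius_pos greater]
    by (simp add: hyp_f_log_radius)
  with greater assms show ?thesis by (simp add: zero_less_divide_iff)
qed (simp add: hyp_f_log_radius)

lemma hyp_f_zero_iff:
  "hyp_f \<nu> c t = 0 \<longleftrightarrow> t = - log_radius \<nu> c \<or> t = 0 \<or> t = log_radius \<nu> c"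
proof -
  have pos: "hyp_f \<nu> c s = 0 \<longleftrightarrow> s = log_radius \<nu> c" if "0 < s" for s
    using hyp_f_unique_pos_root[OF \<nu> c] that log_radius_pos hyp_f_log_radius by blast
  show ?thesis
  proof (cases t "0 :: real" rule: linorder_cases)
    case less
    thus ?thesis using pos[of "- t"] log_radius_pos by (auto simp: hyp_f_odd)
  next
    case greater
    thus ?thesis using pos[of t] log_radius_pos by auto
  qed (simp add: hyp_f_def)
qed

lemma log_radius_less: "log_radius \<nu> c < 2 * ln (\<nu> - 1) / (\<nu> - 4)"
  using hyp_f_pos_at_bound[OF \<nu> c(1)] \<nu> by (subst (asm) hyp_f_pos_iff) auto

end

text \<open>For fixed \<open>t > 0\<close> the value \<open>hyp_f \<nu> c t\<close> increases with \<open>c\<close>. So the zero for \<open>c\<close> is a point where the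
  function for \<open>d\<close> is nonnegative, and the zero for \<open>d\<close> cannot lie beyond it.\<close>

lemma log_radius_antimono:
  assumes "\<nu> \<ge> 5" "0 \<le> c" "c \<le> d" "d \<le> 1"
  shows "log_radius \<nu> d \<le> log_radius \<nu> c"
proof (rule ccontr)
  let ?t = "log_radius \<nu> c"
  assume "\<not> log_radius \<nu> d \<le> ?t"
  have t: "0 < ?t" using assms by (intro log_radius_pos) auto
  have d: "0 < log_radius \<nu> d" using assms by (intro log_radius_pos) auto
  have "0 \<le> 2 * (\<nu> - 1) * (d - c) * sinh ((\<nu> - 4) / 2 * ?t)"
    using assms t by (intro mult_nonneg_nonneg) auto
  also have "\<dots> = hyp_f \<nu> d ?t - hyp_f \<nu> c ?t"
    by (simp add: hyp_f_def algebra_simps)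
  finally have "0 \<le> hyp_f \<nu> d ?t"
    using hyp_f_log_radius[of \<nu> c] assms by simp
  moreover have "hyp_f \<nu> d ?t \<noteq> 0"
    using t d \<open>\<not> log_radius \<nu> d \<le> ?t\<close> assms by (subst hyp_f_zero_iff) auto
  ultimately have "0 < hyp_f \<nu> d ?t" by simp
  hence "log_radius \<nu> d < ?t" using t assms by (subst (asm) hyp_f_pos_iff) auto
  with \<open>\<not> log_radius \<nu> d \<le> ?t\<close> show False by simp
qed

section \<open>Modulus of the Laguerre function\<close>

lemma abs_cos_half: "\<bar>cos (x / 2)\<bar> = sqrt ((1 + cos x) / 2)"
  for x :: real
proof -
  have "1 + cos x = 2 * (cos (x / 2))\<^sup>2"
    using cos_double_cos[of "x / 2"] by simp
  thus ?thesis by simp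
qed

text \<open>The principal square root has nonnegative real part, which is why the absolute value of the cosine
  appears for every \<open>\<theta>\<close>, even though \<open>n * \<theta> / 2\<close> need not be the argument of the root.\<close>

lemma Re_csqrt_power_rcis:
  assumes "0 \<le> r"
  shows "Re (csqrt (rcis r \<theta> ^ n)) = cmod (csqrt (rcis r \<theta> ^ n)) * \<bar>cos (real n * \<theta> / 2)\<bar>"
proof -
  have "(r ^ n + r ^ n * cos (real n * \<theta>)) / 2 = r ^ n * ((1 + cos (real n * \<theta>)) / 2)"
    by (simp add: algebra_simps)
  hence "Re (csqrt (rcis (r ^ n) (real n * \<theta>)))
      = sqrt (r ^ n) * \<bar>cos (real n * \<theta> / 2)\<bar>"
    using assms by (simp add: abs_cos_half flip: real_sqrt_mult)
  moreover have "cmod (csqrt (rcis (r ^ n) (real n * \<theta>))) = sqrt (r ^ n)"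
    using assms by (simp add: norm_csqrt power_abs)
  ultimately show ?thesis by (simp only: DeMoivre2)
qed

lemma cmod_add_real_power2: "(cmod (w + of_real m))\<^sup>2 = (cmod w)\<^sup>2 + 2 * m * Re w + m\<^sup>2"
  unfolding cmod_power2 by (simp add: algebra_simps power2_eq_square)

text \<open>With \<open>w\<close>, \<open>m\<close>, \<open>P\<close>, \<open>Q\<close> as in the proof, \<open>\<bar>L_p z\<bar> = Q / (r * P)\<close> and \<open>r ^ 4 * lag_f n r \<theta> = P\<^sup>2 - Q\<^sup>2\<close>. The
  denominator \<open>w + m\<close> does not vanish, because \<open>Re w \<ge> 0\<close> and \<open>m > 0\<close>.\<close>

lemma sgn_lag_f:
  assumes "n \<ge> 4" "0 < r"
  shows "sgn (lag_f n r \<theta>) = sgn (1 / r - cmod (laguerre n (rcis r \<theta>)))"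
proof -
  define z w where "z = rcis r \<theta>" and "w = csqrt (z ^ n)"
  define m where "m = real n - 1"
  define c where "c = \<bar>cos (real n * \<theta> / 2)\<bar>"
  define P Q where "P = cmod w * cmod (w + of_real m)" and "Q = r\<^sup>2 * cmod (1 + of_real m * w)"
  have m: "0 < m" using assms by (simp add: m_def)
  have z: "cmod z = r" using assms by (simp add: z_def)
  have w2: "(cmod w)\<^sup>2 = r ^ n"
    unfolding w_def by (simp add: norm_power[symmetric] power2_csqrt) (simp add: norm_power z)
  have w0: "w \<noteq> 0" using w2 assms by auto
  have wp: "cmod w = r powr (real n / 2)"
  proof -
    have "(r powr (real n / 2))\<^sup>2 = r ^ n"
      using assms by (simp add: powr_power powr_realpow)
    with w2 show ?thesis by (metis norm_ge_zero powr_ge_zero power2_eq_iff_nonneg)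
  qed
  have Re: "Re w = cmod w * c"
    unfolding w_def z_def c_def using assms by (intro Re_csqrt_power_rcis) auto
  have "0 \<le> Re w" unfolding Re c_def by simp
  hence "w + of_real m \<noteq> 0" using m by (auto simp: complex_eq_iff)
  hence P: "0 < P" using w0 by (simp add: P_def)
  have Q: "0 \<le> Q" by (simp add: Q_def)
  have L: "cmod (laguerre n z) = Q / (r * P)"
  proof -
    have "laguerre n z = z * ((1 + of_real m * w) / (w * (w + of_real m)))"
      unfolding laguerre_def w_def[symmetric] using w0 by (simp add: m_def field_simps)
    thus ?thesis using assms
      by (simp add: norm_mult norm_divide z P_def Q_def power2_eq_square)
  qed
  have P2: "P\<^sup>2 = r ^ n * (r ^ n + 2 * m * c * cmod w + m\<^sup>2)"
    unfolding P_def power_mult_distrib cmod_add_real_power2 w2 Re by (simp add: algebra_simps)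
  have "(cmod (1 + of_real m * w))\<^sup>2 = (cmod (of_real m * w + of_real 1))\<^sup>2"
    by (simp add: add.commute)
  also have "\<dots> = m\<^sup>2 * r ^ n + 2 * m * c * cmod w + 1"
    unfolding cmod_add_real_power2 using Re by (simp add: norm_mult power_mult_distrib w2)
  finally have Q2: "Q\<^sup>2 = r ^ 4 * (m\<^sup>2 * r ^ n + 2 * m * c * cmod w + 1)"
    by (simp add: Q_def power_mult_distrib)
  have r1: "r ^ n = r ^ (n - 4) * r ^ 4"
    using assms by (simp add: power_add[symmetric])
  have r2: "r ^ (2 * n - 4) = r ^ (n - 4) * r ^ n"
    using assms by (simp add: power_add[symmetric] mult_2)
  have "r ^ 4 * lag_f n r \<theta> = P\<^sup>2 - Q\<^sup>2"
    unfolding P2 Q2 lag_f_def m_def[symmetric] c_def[symmetric] wp[symmetric] r2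
    by (simp add: r1) (simp add: algebra_simps power2_eq_square)
  also have "\<dots> = r * P * (P + Q) * (1 / r - cmod (laguerre n z))"
    unfolding L using assms P by (simp add: field_simps power2_eq_square)
  finally have "sgn (r ^ 4 * lag_f n r \<theta>) = sgn (r * P * (P + Q) * (1 / r - cmod (laguerre n z)))"
    by simp
  thus ?thesis using assms P Q by (simp add: sgn_mult z_def)
qed

section \<open>The angles of extremal radius\<close>

lemma angles0_cos:
  assumes "n > 0" "a \<in> angles0 n" shows "cos (real n * a) = 1"
proof -
  obtain k m where "a = 2 * real k * pi / real n + 2 * pi * real_of_int m"
    using assms by (auto simp: angles0_def)
  hence "real n * a = 2 * pi * of_int (int k + int n * m)"
    using assms by (simp add: field_simps)
  thus ?thesis by (simp only: cos_int_2pin)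
qed

lemma angles1_cos:
  assumes "n > 0" "a \<in> angles1 n" shows "cos (real n * a) = - 1"
proof -
  obtain k m where "a = (2 * real k + 1) * pi / real n + 2 * pi * real_of_int m"
    using assms by (auto simp: angles1_def)
  hence "real n * a = 2 * pi * of_int (int k + int n * m) + pi"
    using assms by (simp add: field_simps)
  thus ?thesis by (simp only: cos_periodic_pi cos_int_2pin)
qed

text \<open>The translates by \<open>2 * pi\<close> complete the \<open>n\<close> angles of either family to all even and all odd multiples
  of \<open>pi / n\<close>, so consecutive angles are consecutive multiples.\<close>

lemma angles_Un:
  assumes "n > 0"
  shows "angles0 n \<union> angles1 n = range (\<lambda>j. real_of_int j * pi / real n)"
proof (intro equalityI subsetI)
  fix a assume "a \<in> angles0 n \<union> angles1 n"
  then consider k m where "a = 2 * real k * pi / real n + 2 * pi * real_of_int m"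
    | k m where "a = (2 * real k + 1) * pi / real n + 2 * pi * real_of_int m"
    by (auto simp: angles0_def angles1_def)
  thus "a \<in> range (\<lambda>j. real_of_int j * pi / real n)"
  proof cases
    case (1 k m)
    show ?thesis using assms 1
      by (intro range_eqI[of _ _ "2 * int k + 2 * int n * m"]) (simp add: field_simps)
  next
    case (2 k m)
    show ?thesis using assms 2
      by (intro range_eqI[of _ _ "2 * int k + 1 + 2 * int n * m"]) (simp add: field_simps)
  qed
next
  fix a assume "a \<in> range (\<lambda>j. real_of_int j * pi / real n)"
  then obtain j where a: "a = real_of_int j * pi / real n" by auto
  define i where "i = j div 2"
  define k where "k = nat (i mod int n)"
  have k: "k < n" "int k = i mod int n"
    using assms by (auto simp: k_def nat_less_iff)
  have "i = int k + int n * (i div int n)" using k by simp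
  hence i: "real_of_int i = real k + real n * real_of_int (i div int n)"
    by (metis of_int_add of_int_mult of_int_of_nat_eq)
  show "a \<in> angles0 n \<union> angles1 n"
  proof (cases "even j")
    case True
    hence "j = 2 * i" by (simp add: i_def)
    hence "a = 2 * real k * pi / real n + 2 * pi * real_of_int (i div int n)"
      using assms by (simp add: a i field_simps)
    thus ?thesis using k by (auto simp: angles0_def)
  next
    case False
    hence "j = 2 * i + 1" by (simp add: i_def)
    hence "a = (2 * real k + 1) * pi / real n + 2 * pi * real_of_int (i div int n)"
      using assms by (simp add: a i field_simps)
    thus ?thesis using k by (auto simp: angles1_def)
  qed
qed

lemma cos_monotonic_between_multiples_pi:
  "monotonic_on {real_of_int j * pi..(real_of_int j + 1) * pi} cos"
proof -
  have sin: "sin (real_of_int j * pi) = 0" by (simp add: sin_zero_iff_int2)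
  hence shift: "cos x = cos (real_of_int j * pi) * cos (x - real_of_int j * pi)" for x
    using cos_add[of "real_of_int j * pi" "x - real_of_int j * pi"] by simp
  have anti: "cos (y - real_of_int j * pi) \<le> cos (x - real_of_int j * pi)"
    if "real_of_int j * pi \<le> x" "x \<le> y" "y \<le> (real_of_int j + 1) * pi" for x y
    using that by (intro cos_monotone_0_pi_le) (auto simp: algebra_simps)
  have "cos (real_of_int j * pi) = 1 \<or> cos (real_of_int j * pi) = - 1"
    using sin_cos_squared_add[of "real_of_int j * pi"] unfolding sin
    by (metis add_0 power2_eq_1_iff zero_power2)
  thus ?thesis
  proof
    assume "cos (real_of_int j * pi) = 1"
    hence "cos y \<le> cos x"
      if "real_of_int j * pi \<le> x" "x \<le> y" "y \<le> (real_of_int j + 1) * pi" for x y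
      using anti[OF that] shift[of x] shift[of y] by simp
    thus ?thesis unfolding monotonic_on_def monotone_on_def by simp
  next
    assume "cos (real_of_int j * pi) = - 1"
    hence "cos x \<le> cos y"
      if "real_of_int j * pi \<le> x" "x \<le> y" "y \<le> (real_of_int j + 1) * pi" for x y
      using anti[OF that] shift[of x] shift[of y] by simp
    thus ?thesis unfolding monotonic_on_def monotone_on_def by simp
  qed
qed

lemma cos_monotonic_between_consecutive_angles:
  assumes "n > 0" "consecutive_in (angles0 n \<union> angles1 n) a b"
  shows "monotonic_on {a..b} (\<lambda>\<theta>. cos (real n * \<theta>))"
proof -
  have A: "angles0 n \<union> angles1 n = range (\<lambda>j. real_of_int j * pi / real n)"
    using assms(1) by (rule angles_Un)
  obtain j where a: "a = real_of_int j * pi / real n"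
    using assms(2) unfolding consecutive_in_def A by auto
  \<comment> \<open>the next multiple of \<open>pi / n\<close>; the interval cannot extend past it\<close>
  define b' where "b' = real_of_int (j + 1) * pi / real n"
  have "b' \<in> angles0 n \<union> angles1 n" unfolding A b'_def by blast
  moreover have "a < b'" using assms(1) by (simp add: a b'_def field_simps)
  ultimately have "b \<le> b'" using assms(2) unfolding consecutive_in_def by force
  have "real n * \<theta> \<in> {real_of_int j * pi..(real_of_int j + 1) * pi}" if "\<theta> \<in> {a..b}" for \<theta>
  proof -
    have "a \<le> \<theta>" "\<theta> \<le> b'" using that \<open>b \<le> b'\<close> by auto
    thus ?thesis using assms(1) unfolding a b'_def by (simp add: field_simps)
  qed
  hence sub: "(\<lambda>\<theta>. real n * \<theta>) ` {a..b} \<subseteq> {real_of_int j * pi..(real_of_int j + 1) * pi}"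
    by blast
  have mono: "mono_on {a..b} (\<lambda>\<theta>. real n * \<theta>)"
    by (intro mono_onI mult_left_mono) auto
  show ?thesis
    using cos_monotonic_between_multiples_pi[of j] monotone_on_o[OF _ mono sub, of _ cos]
    unfolding monotonic_on_def o_def by blast
qed

text \<open>The next two lemmas are applied with \<open>u \<theta> = cos (n * \<theta>)\<close>. Their second premise says that \<open>g\<close> is a
  monotone function of \<open>u\<close>, without naming that function.\<close>

lemma monotonic_on_decreasing_comp:
  assumes "monotonic_on I u" "\<And>x y. u x \<le> u y \<Longrightarrow> g y \<le> g x"
  shows "monotonic_on I g"
  using assms(1) unfolding monotonic_on_def monotone_on_def by (auto intro: assms(2))

lemma monotonic_on_increasing_comp:
  assumes "monotonic_on I u" "\<And>x y. u x \<le> u y \<Longrightarrow> g x \<le> g y"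
  shows "monotonic_on I g"
  using assms(1) unfolding monotonic_on_def monotone_on_def by (auto intro: assms(2))

section \<open>The two polar curves\<close>

definition radius_E :: "nat \<Rightarrow> real \<Rightarrow> real" where
  "radius_E n \<theta> = exp (log_radius (real n) \<bar>cos (real n * \<theta> / 2)\<bar>)"

definition radius_D :: "nat \<Rightarrow> real \<Rightarrow> real" where
  "radius_D n \<theta> = exp (- log_radius (real n) \<bar>cos (real n * \<theta> / 2)\<bar>)"

context
  fixes n :: nat
  assumes n: "n \<ge> 5"
begin

lemma radius_D_pos: "0 < radius_D n \<theta>"
  and radius_E_eq: "radius_E n \<theta> = 1 / radius_D n \<theta>"
  by (auto simp: radius_D_def radius_E_def exp_minus field_simps)

lemma radius_D_less_1: "radius_D n \<theta> < 1" and radius_E_gt_1: "1 < radius_E n \<theta>"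
  using n by (auto simp: radius_D_def radius_E_def intro!: log_radius_pos)

lemma lag_f_zero_iff:
  assumes "0 < r"
  shows "lag_f n r \<theta> = 0 \<longleftrightarrow> r = radius_D n \<theta> \<or> r = 1 \<or> r = radius_E n \<theta>"
proof -
  have r: "r = exp (ln r)" using assms by simp
  have e: "ln r = t \<longleftrightarrow> r = exp t" for t using assms by auto
  have "lag_f n r \<theta> = 0 \<longleftrightarrow> hyp_f (real n) \<bar>cos (real n * \<theta> / 2)\<bar> (ln r) = 0"
    using n by (subst r, subst lag_f_exp) auto
  also have "\<dots> \<longleftrightarrow> r = radius_D n \<theta> \<or> r = 1 \<or> r = radius_E n \<theta>"
    using n by (subst hyp_f_zero_iff) (auto simp: e radius_D_def radius_E_def simp del: ln_eq_zero_iff)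
  finally show ?thesis .
qed

lemma radius_E_less: "radius_E n \<theta> < (real n - 1) powr (2 / (real n - 4))"
proof -
  have "log_radius (real n) \<bar>cos (real n * \<theta> / 2)\<bar> < 2 * ln (real n - 1) / (real n - 4)"
    using n by (intro log_radius_less) auto
  thus ?thesis using n by (simp add: radius_E_def powr_def)
qed

lemma radius_E_antimono:
  assumes "cos (real n * x) \<le> cos (real n * y)"
  shows "radius_E n y \<le> radius_E n x"
proof -
  have "\<bar>cos (real n * x / 2)\<bar> \<le> \<bar>cos (real n * y / 2)\<bar>"
    using assms by (simp add: abs_cos_half)
  thus ?thesis using n by (auto simp: radius_E_def intro!: log_radius_antimono)
qed

lemma radius_D_mono:
  assumes "cos (real n * x) \<le> cos (real n * y)"
  shows "radius_D n x \<le> radius_D n y"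
  using radius_E_antimono[OF assms] radius_D_pos
  by (simp add: radius_E_eq divide_le_cancel field_simps)

lemma lag_f_sign_iff:
  assumes "0 < r"
  shows "lag_f n r \<theta> = 0 \<longleftrightarrow> cmod (laguerre n (rcis r \<theta>)) = 1 / r"
    and "lag_f n r \<theta> < 0 \<longleftrightarrow> cmod (laguerre n (rcis r \<theta>)) > 1 / r"
    and "lag_f n r \<theta> > 0 \<longleftrightarrow> cmod (laguerre n (rcis r \<theta>)) < 1 / r"
  using sgn_lag_f[of n r \<theta>] n assms by (auto simp: sgn_if split: if_splits)

lemma laguerre_eq_inverse_iff:
  assumes "z \<noteq> 0" "cmod z \<noteq> 1"
  shows "cmod (laguerre n z) = 1 / cmod z \<longleftrightarrow>
    cmod z = radius_D n (Arg z) \<or> cmod z = radius_E n (Arg z)"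
proof -
  have "rcis (cmod z) (Arg z) = z" by (rule rcis_cmod_Arg)
  thus ?thesis
    using lag_f_sign_iff(1)[of "cmod z" "Arg z"] lag_f_zero_iff[of "cmod z" "Arg z"] assms by simp
qed

lemma bd_D_eq: "bd_D n = polar_curve (radius_D n)"
proof (intro equalityI subsetI)
  fix z assume z: "z \<in> bd_D n"
  hence "cmod z = radius_D n (Arg z)"
    using laguerre_eq_inverse_iff[of z] radius_E_gt_1[of "Arg z"] by (auto simp: bd_D_def)
  hence "z = rcis (radius_D n (Arg z)) (Arg z)" by (metis rcis_cmod_Arg)
  thus "z \<in> polar_curve (radius_D n)" by (auto simp: polar_curve_def)
next
  fix z assume "z \<in> polar_curve (radius_D n)"
  then obtain \<theta> where z: "z = rcis (radius_D n \<theta>) \<theta>" by (auto simp: polar_curve_def)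
  have "lag_f n (radius_D n \<theta>) \<theta> = 0" using radius_D_pos by (simp add: lag_f_zero_iff)
  thus "z \<in> bd_D n"
    using radius_D_pos[of \<theta>] radius_D_less_1[of \<theta>] by (simp add: lag_f_sign_iff bd_D_def z)
qed

lemma bd_E_eq: "bd_E n = polar_curve (radius_E n)"
proof (intro equalityI subsetI)
  fix z assume z: "z \<in> bd_E n"
  hence "z \<noteq> 0" "1 < cmod z" by (auto simp: bd_E_def)
  hence "cmod z = radius_E n (Arg z)"
    using z laguerre_eq_inverse_iff[of z] radius_D_less_1[of "Arg z"] by (auto simp: bd_E_def)
  hence "z = rcis (radius_E n (Arg z)) (Arg z)" by (metis rcis_cmod_Arg)
  thus "z \<in> polar_curve (radius_E n)" by (auto simp: polar_curve_def)
next
  fix z assume "z \<in> polar_curve (radius_E n)"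
  then obtain \<theta> where z: "z = rcis (radius_E n \<theta>) \<theta>" by (auto simp: polar_curve_def)
  have E: "1 < radius_E n \<theta>" by (rule radius_E_gt_1)
  hence "lag_f n (radius_E n \<theta>) \<theta> = 0" by (subst lag_f_zero_iff) auto
  hence "cmod (laguerre n (rcis (radius_E n \<theta>) \<theta>)) = 1 / radius_E n \<theta>"
    using E by (subst (asm) lag_f_sign_iff) auto
  thus "z \<in> bd_E n" using E by (simp add: bd_E_def z)
qed

end

text \<open>The outer radius lies between \<open>1\<close> and a bound that tends to \<open>1\<close>; the inner one is its reciprocal.\<close>

lemma radii_tendsto_1:
  "(\<lambda>n. radius_E n \<theta>) \<longlonglongrightarrow> 1" "(\<lambda>n. radius_D n \<theta>) \<longlonglongrightarrow> 1"
proof -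
  show E: "(\<lambda>n. radius_E n \<theta>) \<longlonglongrightarrow> 1"
  proof (rule tendsto_sandwich)
    show "\<forall>\<^sub>F n in sequentially. 1 \<le> radius_E n \<theta>"
      using eventually_ge_at_top[of 5] by eventually_elim (simp add: radius_E_gt_1 less_imp_le)
    show "\<forall>\<^sub>F n in sequentially. radius_E n \<theta> \<le> (real n - 1) powr (2 / (real n - 4))"
      using eventually_ge_at_top[of 5] by eventually_elim (simp add: radius_E_less less_imp_le)
    show "(\<lambda>n. (real n - 1) powr (2 / (real n - 4))) \<longlonglongrightarrow> 1" by real_asymp
  qed simp
  have "(\<lambda>n. inverse (radius_E n \<theta>)) \<longlonglongrightarrow> inverse 1"
    using E by (intro tendsto_inverse) auto
  thus "(\<lambda>n. radius_D n \<theta>) \<longlonglongrightarrow> 1"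
    by (simp add: radius_E_def radius_D_def exp_minus)
qed

section \<open>The theorem on the sets and their separating curves\<close>

theorem theorem5p1:
  shows "\<exists>rD rE :: nat \<Rightarrow> real \<Rightarrow> real.
    (\<forall>n\<ge>5.
      (\<forall>\<theta>. {r. 0 < r \<and> lag_f n r \<theta> = 0} = {rD n \<theta>, 1, rE n \<theta>}
           \<and> rD n \<theta> < 1 \<and> 1 < rE n \<theta> \<and> rE n \<theta> = 1 / rD n \<theta>
           \<and> rE n \<theta> < (real n - 1) powr (2 / (real n - 4)))
      \<and> (\<forall>r \<theta> z. 0 < r \<longrightarrow> z = rcis r \<theta> \<longrightarrow>
            (lag_f n r \<theta> = 0 \<longleftrightarrow> cmod (laguerre n z) = 1 / cmod z)
          \<and> (cmod (laguerre n z) = 1 / cmod z \<longleftrightarrow> z \<in> bd_D n \<union> unit_circle \<union> bd_E n)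
          \<and> (lag_f n r \<theta> < 0 \<longleftrightarrow> cmod (laguerre n z) > 1 / cmod z)
          \<and> (cmod (laguerre n z) > 1 / cmod z \<longleftrightarrow> z \<in> set_D n \<union> set_K1 n)
          \<and> (lag_f n r \<theta> > 0 \<longleftrightarrow> cmod (laguerre n z) < 1 / cmod z)
          \<and> (cmod (laguerre n z) < 1 / cmod z \<longleftrightarrow> z \<in> set_K0 n \<union> set_E n))
      \<and> bd_D n = polar_curve (rD n)
      \<and> bd_E n = polar_curve (rE n)
      \<and> (\<forall>a\<in>angles0 n. maximized_at (rD n) a \<and> minimized_at (rE n) a)
      \<and> (\<forall>a\<in>angles1 n. minimized_at (rD n) a \<and> maximized_at (rE n) a)
      \<and> (\<forall>a b. consecutive_in (angles0 n \<union> angles1 n) a b \<longrightarrow>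
            monotonic_on {a..b} (rD n) \<and> monotonic_on {a..b} (rE n)))
    \<and> (\<forall>\<theta>. (\<lambda>n. rD n \<theta>) \<longlonglongrightarrow> 1 \<and> (\<lambda>n. rE n \<theta>) \<longlonglongrightarrow> 1)"
proof (rule exI[of _ radius_D], rule exI[of _ radius_E], intro conjI allI impI ballI)
  fix n :: nat and \<theta> :: real assume n: "5 \<le> n"
  show "{r. 0 < r \<and> lag_f n r \<theta> = 0} = {radius_D n \<theta>, 1, radius_E n \<theta>}"
    using lag_f_zero_iff[OF n] radius_D_pos[OF n, of \<theta>] radius_E_gt_1[OF n, of \<theta>] by auto
  show "radius_D n \<theta> < 1" "1 < radius_E n \<theta>" "radius_E n \<theta> = 1 / radius_D n \<theta>"
    "radius_E n \<theta> < (real n - 1) powr (2 / (real n - 4))"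
    using n by (rule radius_D_less_1 radius_E_gt_1 radius_E_eq radius_E_less)+
next
  fix n :: nat and r \<theta> :: real and z
  assume n: "5 \<le> n" and r: "0 < r" and z: "z = rcis r \<theta>"
  have cz: "cmod z = r" using r z by simp
  show "lag_f n r \<theta> = 0 \<longleftrightarrow> cmod (laguerre n z) = 1 / cmod z"
    "lag_f n r \<theta> < 0 \<longleftrightarrow> cmod (laguerre n z) > 1 / cmod z"
    "lag_f n r \<theta> > 0 \<longleftrightarrow> cmod (laguerre n z) < 1 / cmod z"
    unfolding cz unfolding z by (rule lag_f_sign_iff[OF n r])+
  have one: "cmod (laguerre n z) = 1 / cmod z" if "cmod z = 1"
    using lag_f_zero_iff[OF n r, of \<theta>] lag_f_sign_iff(1)[OF n r, of \<theta>] that cz z by simp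
  show "cmod (laguerre n z) = 1 / cmod z \<longleftrightarrow> z \<in> bd_D n \<union> unit_circle \<union> bd_E n"
    using one r cz by (auto simp: bd_D_def unit_circle_def bd_E_def)
  show "cmod (laguerre n z) > 1 / cmod z \<longleftrightarrow> z \<in> set_D n \<union> set_K1 n"
    "cmod (laguerre n z) < 1 / cmod z \<longleftrightarrow> z \<in> set_K0 n \<union> set_E n"
    using one r cz
    by (cases "cmod z" "1 :: real" rule: linorder_cases;
        force simp: set_D_def set_K1_def set_K0_def set_E_def)+
next
  fix n :: nat assume n: "5 \<le> n"
  show "bd_D n = polar_curve (radius_D n)" "bd_E n = polar_curve (radius_E n)"
    using n by (rule bd_D_eq bd_E_eq)+
next
  fix n :: nat and a assume n: "5 \<le> n" and a: "a \<in> angles0 n"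
  have "cos (real n * \<theta>) \<le> cos (real n * a)" for \<theta>
    using n a by (simp add: angles0_cos)
  thus "maximized_at (radius_D n) a" "minimized_at (radius_E n) a"
    using n by (auto simp: maximized_at_def minimized_at_def intro: radius_D_mono radius_E_antimono)
next
  fix n :: nat and a assume n: "5 \<le> n" and a: "a \<in> angles1 n"
  have "cos (real n * a) \<le> cos (real n * \<theta>)" for \<theta>
    using n a by (simp add: angles1_cos)
  thus "minimized_at (radius_D n) a" "maximized_at (radius_E n) a"
    using n by (auto simp: maximized_at_def minimized_at_def intro: radius_D_mono radius_E_antimono)
next
  fix n :: nat and a b
  assume n: "5 \<le> n" and ab: "consecutive_in (angles0 n \<union> angles1 n) a b"
  have cos: "monotonic_on {a..b} (\<lambda>\<theta>. cos (real n * \<theta>))"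
    using n ab by (intro cos_monotonic_between_consecutive_angles) auto
  show "monotonic_on {a..b} (radius_D n)"
    using cos radius_D_mono[OF n] by (rule monotonic_on_increasing_comp)
  show "monotonic_on {a..b} (radius_E n)"
    using cos radius_E_antimono[OF n] by (rule monotonic_on_decreasing_comp)
qed (rule radii_tendsto_1)+

end
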